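(* Consider an agent with starting feature vector $x_0\in\mathbb{R}^n$ facing the classifier $\mathbf{1}(\theta^Tx\ge\theta_0)$, with the weighted Manhattan cost $c(x,x_0)=\sum_i c_i|x_i-x_{0,i}|$, and let $$x_{\mathrm{NB}}:=\arg\max_{x}\; r\,\mathbf{1}(\theta^Tx\ge\theta_0)-c(x,x_0)\quad\text{subject to}\quad c(x,x_0)\le B .$$ Let $e_i$ be the unit vector with $1$ in the $i$-th coordinate and $0$ elsewhere, and let $k=\arg\min_i\frac{c_i}{\theta_i}$. If $\theta^Tx_0+\frac{\theta_k}{c_k}B\ge\theta_0$, then $$x_{\mathrm{NB}}=x_0+(\theta_0-\theta^Tx_0)\frac{c_k}{\theta_k}\,e_k .$$ Otherwise, $x_{\mathrm{NB}}=x_0$. For behaviorally biased agents, whose response $x_{\mathrm{B}}$ is the solution of the same problem with $\mathbf{1}(\theta^Tx\ge\theta_0)$ replaced by $\mathbf{1}(w(\theta)^Tx\ge\theta_0)$, $x_{\mathrm{B}}$ is obtained similarly by replacing $\theta$ with $w(\theta)$.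
   Context: Strategic classification: a firm uses the threshold classifier $h(x,(\theta,\theta_0))=\mathbf{1}(\theta^Tx\ge\theta_0)$, where $\mathbf 1(\cdot)$ is the indicator function and $\theta=[\theta_1,\dots,\theta_n]^T$ is the vector of feature weights, normalized so that $\sum_i\theta_i=1$ and interpreted as a probability vector. An agent with initial features $x_0$ changes them to $x$ at cost $c(x,x_0)$, with cost coefficients $c_i$; $r>0$ is the reward of positive classification and $B$ is the agent's budget. A rational ("non-behavioral") agent responds to the true weights $\theta$; a behaviorally biased agent misperceives $\theta$ as $w(\theta)$, where $w(\cdot)$ is a function capturing the agent's biases, and responds to $(w(\theta),\theta_0)$.
   Formalization: Displacement corrected to (θ0−θᵀx0)/θ_k (printed c_k factor is wrong); the first case also assumes θᵀx0≤θ0 and move cost ≤r, with uniqueness if cost <r and k is the unique argmin; assumes c_i>0, B≥0, w(θ)≥0 and nonzero. Same for w(θ). *)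

theory Defs
  imports "HOL-Analysis.Analysis"
begin

definition classify :: "real ^ 'n \<Rightarrow> (real ^ 'n) \<times> real \<Rightarrow> real" where
  "classify x h = of_bool (fst h \<bullet> x \<ge> snd h)"

definition manhattan_cost :: "real ^ 'n \<Rightarrow> real ^ 'n \<Rightarrow> real ^ 'n \<Rightarrow> real" where
  "manhattan_cost c x x0 = (\<Sum>i\<in>UNIV. c $ i * \<bar>x $ i - x0 $ i\<bar>)"

text \<open>
  The argmax of the agent's problem is a set: it may have several elements, e.g. when two
  features share the smallest cost-to-weight ratio. The pair \<open>h\<close> consists of the weights
  the agent believes in and the threshold.
\<close>

definition best_responses ::
    "real \<Rightarrow> real \<Rightarrow> real ^ 'n \<Rightarrow> (real ^ 'n) \<times> real \<Rightarrow> real ^ 'n \<Rightarrow> (real ^ 'n) set" where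
  "best_responses r B c h x0 =
     {x. is_arg_max (\<lambda>x. r * classify x h - manhattan_cost c x x0)
           (\<lambda>x. manhattan_cost c x x0 \<le> B) x}"

text \<open>
  The ratios are taken in the extended reals, so that a feature of weight \<open>0\<close> and positive
  cost has ratio \<open>\<infinity>\<close>; over the reals it would have ratio \<open>0\<close> and be selected.
\<close>

definition cheapest_features :: "real ^ 'n \<Rightarrow> real ^ 'n \<Rightarrow> 'n set" where
  "cheapest_features c \<theta> =
     {k. is_arg_min (\<lambda>i. ereal (c $ i) / ereal (\<theta> $ i)) (\<lambda>_. True) k}"

end

theory Submission
  imports Defs
begin

text \<open>
  Write \<open>d = x - x0\<close>. If \<open>k\<close> minimises \<open>c\<^sub>i / \<theta>\<^sub>i\<close>, then every term of the sum
  \<open>\<Sum>i. \<theta>\<^sub>k c\<^sub>i \<bar>d\<^sub>i\<bar> - c\<^sub>k \<theta>\<^sub>i d\<^sub>i\<close> is nonnegative, so a move of cost \<open>C\<close> raises the score by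
  at most \<open>\<theta>\<^sub>k C / c\<^sub>k\<close>. Hence the threshold is either out of reach within the budget, and
  moving is a pure loss, or it is reached most cheaply by moving along feature \<open>k\<close>. If \<open>k\<close> is
  the only minimiser, the terms with \<open>i \<noteq> k\<close> vanish only when \<open>d\<^sub>i = 0\<close>, so the cheapest move
  is unique.
\<close>

section \<open>Cost-to-weight ratios\<close>

lemma cheapest_features_pos:
  fixes c v :: "real ^ 'n"
  assumes v: "\<And>i. 0 \<le> v $ i" "v \<noteq> 0" and c: "\<And>i. 0 < c $ i"
    and k: "k \<in> cheapest_features c v"
  shows "0 < v $ k"
proof (rule ccontr)
  assume "\<not> 0 < v $ k"
  with v(1)[of k] have vk: "v $ k = 0" by simp
  obtain j where "v $ j \<noteq> 0" using v(2) by (metis vec_eq_iff zero_index)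
  \<comment> \<open>Zero weight and positive cost give \<open>k\<close> the ratio \<infinity>, while
    that of \<open>j\<close> is finite, so \<open>k\<close> would not be minimal.\<close>
  with vk c[of k] have "ereal (c $ j) / ereal (v $ j) < ereal (c $ k) / ereal (v $ k)"
    by (simp add: zero_ereal_def[symmetric] divide_ereal_def)
  with k show False
    by (auto simp: cheapest_features_def is_arg_min_def)
qed

text \<open>Cross-multiplication returns to the reals. If \<open>q = 0\<close>, the right-hand ratio
  is \<infinity> and the claim is only that \<open>p * b\<close> is nonnegative.\<close>

lemma ereal_ratio_le_imp:
  assumes "0 < a" "0 < b" "0 < p" "0 \<le> q" "ereal a / ereal p \<le> ereal b / ereal q"
  shows "q * a \<le> p * b"
  using assms by (cases "q = 0") (simp_all add: field_simps)

lemma ereal_ratio_less_imp: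
  assumes "0 < a" "0 < b" "0 < p" "0 \<le> q" "ereal a / ereal p < ereal b / ereal q"
  shows "q * a < p * b"
  using assms by (cases "q = 0") (simp_all add: field_simps)

lemma cheapest_features_le:
  fixes c v :: "real ^ 'n"
  assumes v: "\<And>i. 0 \<le> v $ i" "v \<noteq> 0" and c: "\<And>i. 0 < c $ i"
    and k: "k \<in> cheapest_features c v"
  shows "v $ i * c $ k \<le> v $ k * c $ i"
proof (rule ereal_ratio_le_imp)
  show "ereal (c $ k) / ereal (v $ k) \<le> ereal (c $ i) / ereal (v $ i)"
    using k by (auto simp: cheapest_features_def is_arg_min_def not_less)
qed (use v c cheapest_features_pos[OF v c k] in auto)

lemma cheapest_features_less:
  fixes c v :: "real ^ 'n"
  assumes v: "\<And>i. 0 \<le> v $ i" "v \<noteq> 0" and c: "\<And>i. 0 < c $ i"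
    and k: "cheapest_features c v = {k}" and "i \<noteq> k"
  shows "v $ i * c $ k < v $ k * c $ i"
proof (rule ereal_ratio_less_imp)
  have kc: "k \<in> cheapest_features c v" using k by simp
  show "0 < v $ k" by (rule cheapest_features_pos[OF v c kc])
  \<comment> \<open>Uniqueness gives strictness: some \<open>j\<close> beats \<open>i\<close>, and
    \<open>k\<close> is at least as good as \<open>j\<close>.\<close>
  have "i \<notin> cheapest_features c v" using k \<open>i \<noteq> k\<close> by simp
  then obtain j where "ereal (c $ j) / ereal (v $ j) < ereal (c $ i) / ereal (v $ i)"
    by (auto simp: cheapest_features_def is_arg_min_def)
  moreover have "ereal (c $ k) / ereal (v $ k) \<le> ereal (c $ j) / ereal (v $ j)"
    using kc by (auto simp: cheapest_features_def is_arg_min_def not_less)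
  ultimately show "ereal (c $ k) / ereal (v $ k) < ereal (c $ i) / ereal (v $ i)"
    by (rule le_less_trans[rotated])
qed (use v c in auto)

section \<open>Cost of a move against its gain in score\<close>

lemma manhattan_cost_nonneg:
  assumes "\<And>i. 0 < c $ i"
  shows "0 \<le> manhattan_cost c x x0"
  unfolding manhattan_cost_def by (intro sum_nonneg mult_nonneg_nonneg) (auto simp: assms less_imp_le)

lemma manhattan_cost_eq_0_iff:
  assumes "\<And>i. 0 < c $ i"
  shows "manhattan_cost c x x0 = 0 \<longleftrightarrow> x = x0"
proof -
  have "manhattan_cost c x x0 = 0 \<longleftrightarrow> (\<forall>i\<in>UNIV. c $ i * \<bar>x $ i - x0 $ i\<bar> = 0)"
    unfolding manhattan_cost_def
    by (rule sum_nonneg_eq_0_iff) (simp_all add: assms less_imp_le)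
  also have "\<dots> \<longleftrightarrow> x = x0"
    using assms by (auto simp: vec_eq_iff less_imp_neq[symmetric] dest: less_imp_neq)
  finally show ?thesis .
qed

lemma manhattan_cost_axis:
  "manhattan_cost c (x0 + t *\<^sub>R axis k 1) x0 = c $ k * \<bar>t\<bar>"
proof -
  have "manhattan_cost c (x0 + t *\<^sub>R axis k 1) x0 = (\<Sum>i\<in>UNIV. if i = k then c $ k * \<bar>t\<bar> else 0)"
    unfolding manhattan_cost_def by (rule sum.cong) (auto simp: axis_def)
  then show ?thesis by simp
qed

text \<open>With denominators cleared, comparing cost and gain separates into one inequality per
  coordinate.\<close>

lemma manhattan_cost_diff_gain:
  "v $ k * manhattan_cost c x x0 - c $ k * (v \<bullet> x - v \<bullet> x0)
     = (\<Sum>i\<in>UNIV. v $ k * c $ i * \<bar>x $ i - x0 $ i\<bar> - v $ i * c $ k * (x $ i - x0 $ i))"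
  by (simp add: manhattan_cost_def inner_vec_def sum_distrib_left sum_subtractf[symmetric] algebra_simps)

lemma cost_minus_gain_nonneg:
  fixes d :: real
  assumes "0 \<le> q" "q \<le> p"
  shows "0 \<le> p * \<bar>d\<bar> - q * d"
proof -
  have "q * d \<le> q * \<bar>d\<bar>" using assms by (intro mult_left_mono) auto
  also have "\<dots> \<le> p * \<bar>d\<bar>" using assms by (intro mult_right_mono) auto
  finally show ?thesis by simp
qed

lemma gain_le_manhattan_cost:
  fixes c v :: "real ^ 'n"
  assumes v: "\<And>i. 0 \<le> v $ i" "v \<noteq> 0" and c: "\<And>i. 0 < c $ i"
    and k: "k \<in> cheapest_features c v"
  shows "c $ k * (v \<bullet> x - v \<bullet> x0) \<le> v $ k * manhattan_cost c x x0"
proof -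
  have "0 \<le> v $ k * manhattan_cost c x x0 - c $ k * (v \<bullet> x - v \<bullet> x0)"
    unfolding manhattan_cost_diff_gain
    by (intro sum_nonneg cost_minus_gain_nonneg mult_nonneg_nonneg v
        cheapest_features_le[OF v c k] less_imp_le[OF c])
  then show ?thesis by simp
qed

lemma gain_eq_manhattan_cost_imp_axis:
  fixes c v :: "real ^ 'n"
  assumes v: "\<And>i. 0 \<le> v $ i" "v \<noteq> 0" and c: "\<And>i. 0 < c $ i"
    and k: "cheapest_features c v = {k}"
    and eq: "c $ k * (v \<bullet> x - v \<bullet> x0) = v $ k * manhattan_cost c x x0"
  shows "x = x0 + ((v \<bullet> x - v \<bullet> x0) / v $ k) *\<^sub>R axis k 1"
proof -
  have kc: "k \<in> cheapest_features c v" using k by simp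
  note vk = cheapest_features_pos[OF v c kc]
  let ?f = "\<lambda>i. v $ k * c $ i * \<bar>x $ i - x0 $ i\<bar> - v $ i * c $ k * (x $ i - x0 $ i)"
  have nonneg: "0 \<le> ?f i" for i
    by (intro cost_minus_gain_nonneg mult_nonneg_nonneg v
        cheapest_features_le[OF v c kc] less_imp_le[OF c])
  have "sum ?f UNIV = 0"
    using eq manhattan_cost_diff_gain[of v k c x x0] by simp
  then have f0: "?f i = 0" for i
    using nonneg by (simp add: sum_nonneg_eq_0_iff)
  have off: "x $ i = x0 $ i" if "i \<noteq> k" for i
  proof (rule ccontr)
    assume ne: "x $ i \<noteq> x0 $ i"
    \<comment> \<open>A move along \<open>i\<close> in either direction leaves a positive summand,
      since the ratio of \<open>i\<close> is strictly worse than that of \<open>k\<close>.\<close>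
    have "v $ i * c $ k * (x $ i - x0 $ i) \<le> v $ i * c $ k * \<bar>x $ i - x0 $ i\<bar>"
      by (intro mult_left_mono mult_nonneg_nonneg v less_imp_le[OF c]) simp
    also have "\<dots> < v $ k * c $ i * \<bar>x $ i - x0 $ i\<bar>"
      using ne cheapest_features_less[OF v c k that] by (intro mult_strict_right_mono) auto
    finally show False using f0[of i] by simp
  qed
  have x: "x = x0 + (x $ k - x0 $ k) *\<^sub>R axis k 1"
    by (auto simp: vec_eq_iff axis_def off)
  \<comment> \<open>With only coordinate \<open>k\<close> changed, the gain in score determines the
    displacement.\<close>
  have "v \<bullet> x - v \<bullet> x0 = (\<Sum>i\<in>UNIV. if i = k then v $ k * (x $ k - x0 $ k) else 0)"
    unfolding inner_vec_def sum_subtractf[symmetric]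
    by (rule sum.cong) (auto simp: off algebra_simps)
  then have "(v \<bullet> x - v \<bullet> x0) / v $ k = x $ k - x0 $ k"
    using vk by simp
  with x show ?thesis by simp
qed

section \<open>Best responses on either side of reachability\<close>

lemma best_responses_unreachable:
  fixes c v x0 :: "real ^ 'n"
  assumes v: "\<And>i. 0 \<le> v $ i" "v \<noteq> 0" and c: "\<And>i. 0 < c $ i"
    and k: "k \<in> cheapest_features c v" and B: "0 \<le> B"
    and far: "v \<bullet> x0 + v $ k / c $ k * B < \<theta>0"
  shows "best_responses r B c (v, \<theta>0) x0 = {x0}"
proof -
  have cl: "classify x (v, \<theta>0) = 0" if "manhattan_cost c x x0 \<le> B" for x
  proof -
    have "c $ k * (v \<bullet> x - v \<bullet> x0) \<le> v $ k * B"
      using gain_le_manhattan_cost[OF v c k, of x x0] mult_left_mono[OF that v(1)[of k]] by linarith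
    then have "v \<bullet> x \<le> v \<bullet> x0 + v $ k / c $ k * B"
      using c[of k] by (simp add: field_simps)
    with far show ?thesis by (simp add: classify_def)
  qed
  have x0: "manhattan_cost c x0 x0 = 0" by (simp add: manhattan_cost_def)
  note nn = manhattan_cost_nonneg[OF c, of _ x0]
  show ?thesis
  proof (intro equalityI subsetI)
    fix x assume "x \<in> best_responses r B c (v, \<theta>0) x0"
    then have feas: "manhattan_cost c x x0 \<le> B"
      and opt: "\<And>y. manhattan_cost c y x0 \<le> B \<Longrightarrow>
        \<not> r * classify x (v, \<theta>0) - manhattan_cost c x x0
          < r * classify y (v, \<theta>0) - manhattan_cost c y x0"
      by (auto simp: best_responses_def is_arg_max_def)
    \<comment> \<open>No affordable point earns the reward, so the payoff is minus the cost; staying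
      at \<open>x0\<close> yields 0.\<close>
    have "manhattan_cost c x x0 = 0"
      using opt[of x0] feas nn[of x] x0 B by (simp add: cl)
    then show "x \<in> {x0}" by (simp add: manhattan_cost_eq_0_iff[OF c])
  next
    fix x assume "x \<in> {x0}"
    then show "x \<in> best_responses r B c (v, \<theta>0) x0"
      using nn x0 B by (auto simp: best_responses_def is_arg_max_def cl not_less)
  qed
qed

text \<open>\<open>C\<close> is the cost of moving to \<open>y\<close>, the threshold point along
  feature \<open>k\<close>. The singleton claim takes \<open>C < r\<close>: at \<open>C = r\<close>
  staying put ties with \<open>y\<close>.\<close>

lemma best_responses_reachable:
  fixes c v x0 :: "real ^ 'n"
  assumes v: "\<And>i. 0 \<le> v $ i" "v \<noteq> 0" and c: "\<And>i. 0 < c $ i"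
    and k: "k \<in> cheapest_features c v"
    and reach: "\<theta>0 \<le> v \<bullet> x0 + v $ k / c $ k * B" and below: "v \<bullet> x0 \<le> \<theta>0"
  defines "y \<equiv> x0 + ((\<theta>0 - v \<bullet> x0) / v $ k) *\<^sub>R axis k 1"
    and "C \<equiv> (\<theta>0 - v \<bullet> x0) * (c $ k / v $ k)"
  shows "C \<le> r \<Longrightarrow> y \<in> best_responses r B c (v, \<theta>0) x0"
    and "C < r \<Longrightarrow> cheapest_features c v = {k} \<Longrightarrow> best_responses r B c (v, \<theta>0) x0 = {y}"
proof -
  note vk = cheapest_features_pos[OF v c k]
  \<comment> \<open>By \<open>below\<close> the displacement is nonnegative, so the absolute value
    drops.\<close>
  have cost_y: "manhattan_cost c y x0 = C"
    unfolding y_def manhattan_cost_axis C_def using below vk by simp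
  have C_le: "C \<le> B"
    using reach vk c[of k] by (simp add: C_def field_simps)
  have "v \<bullet> y = \<theta>0"
    using vk by (simp add: y_def inner_add_right inner_axis)
  then have cl_y: "classify y (v, \<theta>0) = 1" by (simp add: classify_def)
  have C_le_cost: "C \<le> manhattan_cost c x x0" if "\<theta>0 \<le> v \<bullet> x" for x
  proof -
    have "c $ k * (\<theta>0 - v \<bullet> x0) \<le> c $ k * (v \<bullet> x - v \<bullet> x0)"
      using that c[of k] by simp
    also have "\<dots> \<le> v $ k * manhattan_cost c x x0"
      by (rule gain_le_manhattan_cost[OF v c k])
    finally show ?thesis using vk by (simp add: C_def field_simps)
  qed
  note nn = manhattan_cost_nonneg[OF c, of _ x0]
  show mem: "y \<in> best_responses r B c (v, \<theta>0) x0" if "C \<le> r"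
  proof -
    \<comment> \<open>Accepted points cost at least \<open>C\<close>; rejected ones have payoff at
      most 0, which is at most \<open>r - C\<close>.\<close>
    have "r * classify x (v, \<theta>0) - manhattan_cost c x x0 \<le> r - C" for x
      using C_le_cost[of x] nn[of x] that by (auto simp: classify_def)
    then show ?thesis
      using C_le by (auto simp: best_responses_def is_arg_max_def cl_y cost_y not_less)
  qed
  show "best_responses r B c (v, \<theta>0) x0 = {y}" if less: "C < r" and uniq: "cheapest_features c v = {k}"
  proof (intro equalityI subsetI)
    fix x assume "x \<in> best_responses r B c (v, \<theta>0) x0"
    then have opt: "r - C \<le> r * classify x (v, \<theta>0) - manhattan_cost c x x0"
      using C_le cl_y cost_y by (force simp: best_responses_def is_arg_max_def not_less)
    have above: "\<theta>0 \<le> v \<bullet> x"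
    proof (rule ccontr)
      assume "\<not> \<theta>0 \<le> v \<bullet> x"
      then have "classify x (v, \<theta>0) = 0" by (simp add: classify_def)
      with opt nn[of x] less show False by simp
    qed
    then have "classify x (v, \<theta>0) = 1" by (simp add: classify_def)
    with opt C_le_cost[OF above] have cost_x: "manhattan_cost c x x0 = C" by simp
    then have "v $ k * manhattan_cost c x x0 = c $ k * (\<theta>0 - v \<bullet> x0)"
      using vk by (simp add: C_def)
    \<comment> \<open>Cost \<open>C\<close> cannot buy a score above \<open>\<theta>0\<close>, so
      \<open>x\<close> lies on the threshold and the equality case identifies it with
      \<open>y\<close>.\<close>
    with gain_le_manhattan_cost[OF v c k, of x x0] have "v \<bullet> x \<le> \<theta>0"
      using c[of k] by simp
    with above have vx: "v \<bullet> x = \<theta>0" by simp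
    have "c $ k * (v \<bullet> x - v \<bullet> x0) = v $ k * manhattan_cost c x x0"
      using vk by (simp add: cost_x C_def vx)
    from gain_eq_manhattan_cost_imp_axis[OF v c uniq this]
    show "x \<in> {y}" by (simp add: y_def vx)
  qed (use mem less in auto)
qed

text \<open>Moving by \<open>t\<close> along feature \<open>k\<close> changes the score by
  \<open>\<theta> $ k * t\<close>, hence the displacement is the score deficit divided by
  \<open>\<theta> $ k\<close>; the factor \<open>c $ k / \<theta> $ k\<close> turns the deficit into
  cost. The bound \<open>\<theta> \<bullet> x0 \<le> \<theta>0\<close> keeps out agents strictly
  above the threshold, who would pay to move down to it. Comparing the cost with \<open>r\<close>
  decides whether the move pays.\<close>

theorem lemma3:
  fixes \<theta> c x0 :: "real ^ 'n"
    and \<theta>0 r B :: real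
    and w :: "real ^ 'n \<Rightarrow> real ^ 'n"
  assumes \<theta>_nonneg: "\<And>i. 0 \<le> \<theta> $ i"
    and \<theta>_sum: "(\<Sum>i\<in>UNIV. \<theta> $ i) = 1"
    and w_nonneg: "\<And>i. 0 \<le> w \<theta> $ i"
    and w_nonzero: "w \<theta> \<noteq> 0"
    and cost_pos: "\<And>i. 0 < c $ i"
    and reward_pos: "0 < r"
    and budget_nonneg: "0 \<le> B"
  shows "(\<forall>k \<in> cheapest_features c \<theta>.
      (\<theta> \<bullet> x0 + \<theta> $ k / c $ k * B \<ge> \<theta>0 \<and> \<theta> \<bullet> x0 \<le> \<theta>0 \<longrightarrow>
         ((\<theta>0 - \<theta> \<bullet> x0) * (c $ k / \<theta> $ k) \<le> r \<longrightarrow>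
            x0 + ((\<theta>0 - \<theta> \<bullet> x0) / \<theta> $ k) *\<^sub>R axis k 1 \<in> best_responses r B c (\<theta>, \<theta>0) x0) \<and>
         ((\<theta>0 - \<theta> \<bullet> x0) * (c $ k / \<theta> $ k) < r \<and> cheapest_features c \<theta> = {k} \<longrightarrow>
            best_responses r B c (\<theta>, \<theta>0) x0 = {x0 + ((\<theta>0 - \<theta> \<bullet> x0) / \<theta> $ k) *\<^sub>R axis k 1})) \<and>
      (\<not> \<theta> \<bullet> x0 + \<theta> $ k / c $ k * B \<ge> \<theta>0 \<longrightarrow>
         best_responses r B c (\<theta>, \<theta>0) x0 = {x0})) \<and>
    (\<forall>k \<in> cheapest_features c (w \<theta>).
      (w \<theta> \<bullet> x0 + w \<theta> $ k / c $ k * B \<ge> \<theta>0 \<and> w \<theta> \<bullet> x0 \<le> \<theta>0 \<longrightarrow>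
         ((\<theta>0 - w \<theta> \<bullet> x0) * (c $ k / w \<theta> $ k) \<le> r \<longrightarrow>
            x0 + ((\<theta>0 - w \<theta> \<bullet> x0) / w \<theta> $ k) *\<^sub>R axis k 1 \<in> best_responses r B c (w \<theta>, \<theta>0) x0) \<and>
         ((\<theta>0 - w \<theta> \<bullet> x0) * (c $ k / w \<theta> $ k) < r \<and> cheapest_features c (w \<theta>) = {k} \<longrightarrow>
            best_responses r B c (w \<theta>, \<theta>0) x0 = {x0 + ((\<theta>0 - w \<theta> \<bullet> x0) / w \<theta> $ k) *\<^sub>R axis k 1})) \<and>
      (\<not> w \<theta> \<bullet> x0 + w \<theta> $ k / c $ k * B \<ge> \<theta>0 \<longrightarrow>
         best_responses r B c (w \<theta>, \<theta>0) x0 = {x0}))"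
proof -
  \<comment> \<open>Weights summing to 1 cannot all vanish, so \<open>\<theta>\<close> and
    \<open>w \<theta>\<close> fall under the same lemmas.\<close>
  have \<theta>_nonzero: "\<theta> \<noteq> 0" using \<theta>_sum by auto
  show ?thesis
    using best_responses_reachable[OF \<theta>_nonneg \<theta>_nonzero cost_pos]
      best_responses_unreachable[OF \<theta>_nonneg \<theta>_nonzero cost_pos _ budget_nonneg]
      best_responses_reachable[OF w_nonneg w_nonzero cost_pos]
      best_responses_unreachable[OF w_nonneg w_nonzero cost_pos _ budget_nonneg]
    by (intro conjI ballI impI) (simp_all add: not_le)
qed

end
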